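(* Let $\mathbb{I}$ be a compact subset of a Euclidean space, $\Phi:\mathbb{I}\to\mathbb{C}^m$ a continuous function, $y\in\mathbb{C}^m$, and $L:\mathbb{C}^m\to\mathbb{R}$ a differentiable function. Suppose that for some $\gamma\ge 1$, $$\frac{\|x-x'\|_2^2}{2\gamma}\le L(x)-L(x')-\mathrm{Re}\langle x-x',\nabla L(x')\rangle\le\frac{\gamma}{2}\|x-x'\|_2^2\qquad\text{for all }x,x'\in\mathbb{C}^m .$$ Consider the algorithms CGM and EM described in the context, run with the same data $\mathbb{I},\Phi,L,y$. Assume that CGM and EM update their supports according to the same rule, i.e. the same rule is used in both algorithms to select the new point $t^l$ among the optimal points of the respective selection problems (e.g. selecting the smallest solution if $\mathbb{I}\subset\mathbb{R}$). Then CGM and EM are equivalent in the sense that $$T^l_{CGM}=T^l_{EM}\quad\text{for every iteration } l\ge 0,$$ where $T^l_{CGM}\subset\mathbb{I}$ and $T^l_{EM}\subset\mathbb{I}$ are the support sets of CGM and EM at iteration $l$, respectively. Furthermore, $$v^l_{CGM}=v^{l+1}_{EM},$$ where $v^l_{CGM}$ denotes the optimal value of the program $(P^l)$ solved by CGM at iteration $l$ and $v^l_{EM}$ denotes the optimal value of the program $(D^l)$ solved by EM at iteration $l$ (both programs are defined in the context).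
   Context: Notation. $\langle\cdot,\cdot\rangle$ is the standard inner product on $\mathbb{C}^m$; $\nabla L$ is the gradient of $L$ with respect to the real inner product $\mathrm{Re}\langle\cdot,\cdot\rangle$ on $\mathbb{C}^m$. $B_+(\mathbb{I})$ is the set of nonnegative Borel measures supported on $\mathbb{I}$, and $\|x\|_{TV}=\int_{\mathbb{I}}x(dt)$ for $x\in B_+(\mathbb{I})$. The Fenchel conjugate of $L$ is $L_\circ(\lambda)=\sup_{z\in\mathbb{C}^m}\mathrm{Re}\langle\lambda,z\rangle-L(z)$. CGM (fully-corrective conditional gradient method) is an algorithm for the program $$\min_x\ L\Big(\int_{\mathbb{I}}\Phi(t)x(dt)-y\Big)\quad\text{subject to}\quad \|x\|_{TV}\le 1,\ x\in B_+(\mathbb{I}).$$ Initialize $T^0=\emptyset$, $x^0\equiv 0$. Given a tolerance $\eta\ge 0$, while $\|\nabla L(\int_{\mathbb{I}}\Phi(\tau)x^{l-1}(d\tau)-y)\|_2>\eta$, iteration $l=1,2,\dots$ does the following: (1) let $t^l$ be a minimizer of $\min_{t\in\mathbb{I}}\mathrm{Re}\big\langle\Phi(t),\nabla L\big(\int_{\mathbb{I}}\Phi(\tau)x^{l-1}(d\tau)-y\big)\big\rangle$; (2) set $T^l=T^{l-1}\cup\{t^l\}$; (3) let $x^l$ be a minimizer of $$(P^l)\qquad\min_x\ L\Big(\int_{\mathbb{I}}\Phi(t)x(dt)-y\Big)\quad\text{subject to}\quad\|x\|_{TV}\le 1,\ \mathrm{supp}(x)\subseteq T^l,\ x\in B_+(\mathbb{I}).$$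 The sets $T^l$ produced by CGM are denoted $T^l_{CGM}$. EM (exchange method) is an algorithm for the Lagrangian dual semi-infinite program $$\max_{\lambda\in\mathbb{C}^m,\alpha\in\mathbb{R}}\ \mathrm{Re}\langle\lambda,y\rangle-L_\circ(-\lambda)-\alpha\quad\text{subject to}\quad\mathrm{Re}\langle\lambda,\Phi(t)\rangle\le\alpha\ \ (t\in\mathbb{I}),\ \alpha\ge 0.$$ Initialize $T^0=\emptyset$. Iteration $l=1,2,\dots$ does the following: (1) let $(\lambda^l,\alpha^l)$ be a maximizer of $$(D^l)\qquad\max_{\lambda\in\mathbb{C}^m,\alpha\in\mathbb{R}}\ \mathrm{Re}\langle\lambda,y\rangle-L_\circ(-\lambda)-\alpha\quad\text{subject to}\quad\mathrm{Re}\langle\lambda,\Phi(t)\rangle\le\alpha\ \ (t\in T^{l-1}),\ \alpha\ge 0;$$ (2) let $t^l$ be a maximizer of $\max_{t\in\mathbb{I}}\mathrm{Re}\langle\lambda^l,\Phi(t)\rangle$; (3) set $T^l=T^{l-1}\cup\{t^l\}$. Given a tolerance $\eta\ge 0$, EM continues as long as $\max_{t\in\mathbb{I}}\mathrm{Re}\langle\lambda^l,\Phi(t)\rangle>\alpha^l+\eta$. The sets $T^l$ produced by EM are denoted $T^l_{EM}$. *)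

theory Defs
  imports "HOL-Analysis.Analysis"
begin

definition cinner :: "complex ^ 'm \<Rightarrow> complex ^ 'm \<Rightarrow> complex" where
  "cinner u v = (\<Sum>i\<in>UNIV. u $ i * cnj (v $ i))"

lemma Re_cinner: "Re (cinner u v) = u \<bullet> v"
  by (simp add: cinner_def inner_vec_def inner_complex_def)

text \<open>By \<open>Re_cinner\<close>, the gradient with respect to the real inner product
  \<open>Re (cinner _ _)\<close> is the one given by \<open>GDERIV\<close>. It is only meaningful at points
  where \<open>L\<close> is differentiable.\<close>

definition grad :: "(complex ^ 'm \<Rightarrow> real) \<Rightarrow> complex ^ 'm \<Rightarrow> complex ^ 'm" where
  "grad L z = (THE g. GDERIV L z :> g)"

definition fenchel_conj :: "(complex ^ 'm \<Rightarrow> real) \<Rightarrow> complex ^ 'm \<Rightarrow> ereal" where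
  "fenchel_conj L lam = (SUP z. ereal (Re (cinner lam z) - L z))"

text \<open>Measures on \<open>I\<close> are represented by Borel measures on the ambient space whose support
  lies in \<open>I\<close>.\<close>

definition msupp :: "'a::topological_space measure \<Rightarrow> 'a set" where
  "msupp x = {t. \<forall>U. open U \<and> t \<in> U \<longrightarrow> emeasure x U > 0}"

definition Bplus :: "'a::euclidean_space set \<Rightarrow> 'a measure set" where
  "Bplus I = {x. sets x = sets borel \<and> msupp x \<subseteq> I}"

definition tv_norm :: "'a::euclidean_space set \<Rightarrow> 'a measure \<Rightarrow> ennreal" where
  "tv_norm I x = (\<integral>\<^sup>+t\<in>I. 1 \<partial>x)"

definition residual ::
  "'a::euclidean_space set \<Rightarrow> ('a \<Rightarrow> complex ^ 'm) \<Rightarrow> complex ^ 'm \<Rightarrow> 'a measure \<Rightarrow> complex ^ 'm"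
where
  "residual I \<Phi> y x = (LINT t:I|x. \<Phi> t) - y"

definition primal_feasible :: "'a::euclidean_space set \<Rightarrow> 'a set \<Rightarrow> 'a measure set" where
  "primal_feasible I T = {x \<in> Bplus I. tv_norm I x \<le> 1 \<and> msupp x \<subseteq> T}"

definition cgm_candidates ::
  "'a::euclidean_space set \<Rightarrow> ('a \<Rightarrow> complex ^ 'm) \<Rightarrow> (complex ^ 'm \<Rightarrow> real) \<Rightarrow> complex ^ 'm
    \<Rightarrow> 'a measure \<Rightarrow> 'a set"
where
  "cgm_candidates I \<Phi> L y x =
     {t. is_arg_min (\<lambda>t. Re (cinner (\<Phi> t) (grad L (residual I \<Phi> y x)))) (\<lambda>t. t \<in> I) t}"

text \<open>\<open>cgm_run I \<Phi> L y \<eta> N T x t\<close>: the method performs (at least) the iterations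
  \<open>1, \<dots>, N\<close> and produces supports \<open>T 0, \<dots>, T N\<close>, measures \<open>x 0, \<dots>, x N\<close> and points
  \<open>t 1, \<dots>, t N\<close>. Values at larger indices are irrelevant. An infinite run is one for which
  this holds for every \<open>N\<close>.\<close>

definition cgm_run ::
  "'a::euclidean_space set \<Rightarrow> ('a \<Rightarrow> complex ^ 'm) \<Rightarrow> (complex ^ 'm \<Rightarrow> real) \<Rightarrow> complex ^ 'm
    \<Rightarrow> real \<Rightarrow> nat \<Rightarrow> (nat \<Rightarrow> 'a set) \<Rightarrow> (nat \<Rightarrow> 'a measure) \<Rightarrow> (nat \<Rightarrow> 'a) \<Rightarrow> bool"
where
  "cgm_run I \<Phi> L y \<eta> N T x t \<longleftrightarrow>
     T 0 = {} \<and> x 0 = null_measure borel \<and>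
     (\<forall>l\<in>{1..N}.
        norm (grad L (residual I \<Phi> y (x (l - 1)))) > \<eta> \<and>
        t l \<in> cgm_candidates I \<Phi> L y (x (l - 1)) \<and>
        T l = T (l - 1) \<union> {t l} \<and>
        is_arg_min (\<lambda>x. L (residual I \<Phi> y x)) (\<lambda>x. x \<in> primal_feasible I (T l)) (x l))"

definition cgm_value ::
  "'a::euclidean_space set \<Rightarrow> ('a \<Rightarrow> complex ^ 'm) \<Rightarrow> (complex ^ 'm \<Rightarrow> real) \<Rightarrow> complex ^ 'm
    \<Rightarrow> (nat \<Rightarrow> 'a set) \<Rightarrow> nat \<Rightarrow> ereal"
where
  "cgm_value I \<Phi> L y T l = (INF x\<in>primal_feasible I (T l). ereal (L (residual I \<Phi> y x)))"

definition dual_objective ::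
  "(complex ^ 'm \<Rightarrow> real) \<Rightarrow> complex ^ 'm \<Rightarrow> (complex ^ 'm) \<times> real \<Rightarrow> ereal"
where
  "dual_objective L y = (\<lambda>(lam, \<alpha>). ereal (Re (cinner lam y)) - fenchel_conj L (- lam) - ereal \<alpha>)"

definition dual_feasible :: "('a \<Rightarrow> complex ^ 'm) \<Rightarrow> 'a set \<Rightarrow> ((complex ^ 'm) \<times> real) set" where
  "dual_feasible \<Phi> T = {(lam, \<alpha>). (\<forall>t\<in>T. Re (cinner lam (\<Phi> t)) \<le> \<alpha>) \<and> \<alpha> \<ge> 0}"

definition em_candidates ::
  "'a set \<Rightarrow> ('a \<Rightarrow> complex ^ 'm) \<Rightarrow> complex ^ 'm \<Rightarrow> 'a set"
where
  "em_candidates I \<Phi> lam = {t. is_arg_max (\<lambda>t. Re (cinner lam (\<Phi> t))) (\<lambda>t. t \<in> I) t}"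

text \<open>As for \<open>cgm_run\<close>, with the difference that the continuation test belongs to the end of
  an iteration: iteration \<open>1\<close> is always performed, and iteration \<open>l > 1\<close> is performed only
  if the test at iteration \<open>l - 1\<close> succeeded.\<close>

definition em_run ::
  "'a::euclidean_space set \<Rightarrow> ('a \<Rightarrow> complex ^ 'm) \<Rightarrow> (complex ^ 'm \<Rightarrow> real) \<Rightarrow> complex ^ 'm
    \<Rightarrow> real \<Rightarrow> nat \<Rightarrow> (nat \<Rightarrow> 'a set) \<Rightarrow> (nat \<Rightarrow> complex ^ 'm) \<Rightarrow> (nat \<Rightarrow> real)
    \<Rightarrow> (nat \<Rightarrow> 'a) \<Rightarrow> bool"
where
  "em_run I \<Phi> L y \<eta> N T lam \<alpha> t \<longleftrightarrow>
     T 0 = {} \<and>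
     (\<forall>l\<in>{1..N}.
        (l > 1 \<longrightarrow> (SUP s\<in>I. Re (cinner (lam (l - 1)) (\<Phi> s))) > \<alpha> (l - 1) + \<eta>) \<and>
        is_arg_max (dual_objective L y) (\<lambda>p. p \<in> dual_feasible \<Phi> (T (l - 1))) (lam l, \<alpha> l) \<and>
        t l \<in> em_candidates I \<Phi> (lam l) \<and>
        T l = T (l - 1) \<union> {t l})"

text \<open>The program solved at iteration \<open>l \<ge> 1\<close> has the constraints indexed by \<open>T (l - 1)\<close>.\<close>

definition em_value ::
  "('a \<Rightarrow> complex ^ 'm) \<Rightarrow> (complex ^ 'm \<Rightarrow> real) \<Rightarrow> complex ^ 'm \<Rightarrow> (nat \<Rightarrow> 'a set) \<Rightarrow> nat \<Rightarrow> ereal"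
where
  "em_value \<Phi> L y T l = (SUP p\<in>dual_feasible \<Phi> (T (l - 1)). dual_objective L y p)"

end

theory Submission
  imports Defs
begin

text \<open>
  The programs \<open>(P\<^sup>l)\<close> and \<open>(D\<^sup>l\<^sup>+\<^sup>1)\<close> are Lagrangian duals of each other when both are built on
  the same finite support \<open>T\<close>. The vectors \<open>\<integral> \<Phi> dx\<close>, with \<open>x\<close> feasible for the first program,
  form the convex hull \<open>K\<close> of \<open>0\<close> and \<open>\<Phi> ` T\<close> (\<open>residual_image_primal_feasible\<close>), so that
  \<open>(P\<^sup>l)\<close> minimizes \<open>L (u - y)\<close> over \<open>u \<in> K\<close>. Dual feasibility of \<open>(lam, \<alpha>)\<close> gives
  \<open>lam \<bullet> u \<le> \<alpha>\<close> on \<open>K\<close>, and with the Fenchel-Young inequality this is weak duality.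

  Let \<open>u\<close> be a minimizer and \<open>g\<close> the gradient of \<open>L\<close> at \<open>u - y\<close>. By the variational inequality on
  \<open>K\<close>, the pair \<open>(- g, - (g \<bullet> u))\<close> is dual feasible, and by equality in Fenchel-Young at the
  subgradient \<open>g\<close> it attains the primal value. Hence the values coincide. Conversely, a dual
  optimal \<open>(lam, \<alpha>)\<close> must turn every inequality of the weak duality argument into an equality.
  Then \<open>- lam\<close> is a subgradient of \<open>L\<close> at \<open>u - y\<close>, and the quadratic upper bound on \<open>L\<close> leaves
  no subgradient there except \<open>g\<close>. So the multiplier of EM is \<open>- \<nabla>L\<close> at the residual of CGM
  (\<open>primal_dual_subproblems\<close>).

  With this multiplier, maximizing \<open>lam \<bullet> \<Phi> t\<close> is the same as minimizing \<open>\<Phi> t \<bullet> \<nabla>L\<close>. The two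
  methods therefore choose from the same set of candidates, the common rule picks the same point,
  and the supports agree by induction.
\<close>

section \<open>Measures supported on a finite set\<close>

lemma open_null_disjoint_msupp:
  assumes "open U" "emeasure x U = 0"
  shows "U \<inter> msupp x = {}"
  using assms by (force simp: msupp_def)

text \<open>The complement of the support is a union of open null sets. Such a union may be
  uncountable, and the Lindelof property replaces it by a countable one.\<close>

lemma compl_msupp_null:
  fixes x :: "'a::second_countable_topology measure"
  assumes x: "sets x = sets borel"
  shows "- msupp x \<in> null_sets x"
proof -
  define F where "F = {U. open U \<and> emeasure x U = 0}"
  obtain F' where F': "F' \<subseteq> F" "countable F'" "\<Union>F' = \<Union>F"
    using Lindelof[of F] unfolding F_def by blast
  have "\<Union>F = - msupp x"
    by (auto simp: F_def msupp_def not_gr_zero)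
  moreover have "U \<in> null_sets x" if "U \<in> F'" for U
    using that F'(1) x by (auto simp: F_def null_sets_def)
  then have "(\<Union>U\<in>F'. U) \<in> null_sets x"
    by (intro null_sets_UN' F'(2))
  ultimately show ?thesis
    using F'(3) by simp
qed

text \<open>The sum of the point masses \<open>w t\<close> at the points of \<open>T\<close>, pushed forward from the discrete
  \<open>\<sigma>\<close>-algebra on \<open>T\<close> to the Borel sets of the ambient space.\<close>

definition atomic_measure :: "'a set \<Rightarrow> ('a \<Rightarrow> real) \<Rightarrow> 'a::euclidean_space measure" where
  "atomic_measure T w = distr (point_measure T (\<lambda>t. ennreal (w t))) borel (\<lambda>t. t)"

lemma sets_atomic_measure [simp]: "sets (atomic_measure T w) = sets borel"
  by (simp add: atomic_measure_def)

lemma measurable_atomic_id: "(\<lambda>t. t) \<in> measurable (point_measure T f) borel"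
  by (simp add: measurable_def space_point_measure sets_point_measure)

lemma emeasure_atomic_measure:
  assumes "finite T" "A \<in> sets borel"
  shows "emeasure (atomic_measure T w) A = (\<Sum>t\<in>T \<inter> A. ennreal (w t))"
proof -
  have "emeasure (atomic_measure T w) A
      = emeasure (point_measure T (\<lambda>t. ennreal (w t))) (T \<inter> A)"
    unfolding atomic_measure_def using assms(2)
    by (subst emeasure_distr[OF measurable_atomic_id])
       (auto simp: space_point_measure intro!: arg_cong[where f = "emeasure _"])
  also have "\<dots> = (\<Sum>t\<in>T \<inter> A. ennreal (w t))"
    using assms(1) by (intro emeasure_point_measure_finite) auto
  finally show ?thesis .
qed

lemma atomic_measure_feasible:
  assumes T: "finite T" "T \<subseteq> I" and I: "closed I"
    and w: "\<And>t. t \<in> T \<Longrightarrow> 0 \<le> w t" "sum w T \<le> 1"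
  shows "atomic_measure T w \<in> primal_feasible I T"
proof -
  let ?x = "atomic_measure T w"
  have "emeasure ?x (- T) = 0"
    using T(1) by (subst emeasure_atomic_measure) (auto simp: finite_imp_closed)
  then have supp: "msupp ?x \<subseteq> T"
    using open_null_disjoint_msupp[of "- T" ?x] T(1) by (auto simp: finite_imp_closed open_Compl)
  have "tv_norm I ?x = emeasure ?x I"
    using I by (simp add: tv_norm_def)
  also have "\<dots> = ennreal (sum w T)"
    using T I w(1) by (subst emeasure_atomic_measure) (auto simp: Int_absorb2 sum_ennreal)
  finally have "tv_norm I ?x \<le> 1"
    using w(2) by (simp add: ennreal_le_1)
  with supp T(2) show ?thesis
    by (auto simp: primal_feasible_def Bplus_def)
qed

lemma set_borel_measurable_continuous_on:
  fixes \<Phi> :: "'a::euclidean_space \<Rightarrow> 'b::euclidean_space"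
  assumes "closed I" "continuous_on I \<Phi>"
  shows "(\<lambda>t. indicator I t *\<^sub>R \<Phi> t) \<in> borel_measurable borel"
  using assms by (intro borel_measurable_continuous_on_indicator) auto

lemma integral_atomic_measure:
  fixes \<Phi> :: "'a::euclidean_space \<Rightarrow> 'b::euclidean_space"
  assumes T: "finite T" "T \<subseteq> I" and I: "closed I" "continuous_on I \<Phi>"
    and w: "\<And>t. t \<in> T \<Longrightarrow> 0 \<le> w t"
  shows "(LINT t:I|atomic_measure T w. \<Phi> t) = (\<Sum>t\<in>T. w t *\<^sub>R \<Phi> t)"
proof -
  have "(LINT t:I|atomic_measure T w. \<Phi> t)
      = integral\<^sup>L (point_measure T (\<lambda>t. ennreal (w t))) (\<lambda>t. indicator I t *\<^sub>R \<Phi> t)"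
    unfolding set_lebesgue_integral_def atomic_measure_def
    by (intro integral_distr measurable_atomic_id set_borel_measurable_continuous_on I)
  also have "\<dots> = (\<Sum>t\<in>T. w t *\<^sub>R (indicator I t *\<^sub>R \<Phi> t))"
    using T(1) w by (simp add: lebesgue_integral_point_measure_finite)
  also have "\<dots> = (\<Sum>t\<in>T. w t *\<^sub>R \<Phi> t)"
    using T(2) by (intro sum.cong) auto
  finally show ?thesis .
qed

text \<open>Almost every point lies in the support, hence in \<open>T\<close>, and there \<open>\<Phi>\<close> is the simple function
  with value \<open>\<Phi> s\<close> at \<open>s \<in> T\<close>. The weights are the masses of the points of \<open>T\<close>, which are finite
  because \<open>T \<subseteq> I\<close> and the total variation on \<open>I\<close> is at most \<open>1\<close>.\<close>

lemma feasible_integral_eq_sum: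
  fixes \<Phi> :: "'a::euclidean_space \<Rightarrow> 'b::euclidean_space"
  assumes T: "finite T" "T \<subseteq> I" and I: "closed I" "continuous_on I \<Phi>"
    and x: "x \<in> primal_feasible I T"
  shows "(LINT t:I|x. \<Phi> t) = (\<Sum>t\<in>T. measure x {t} *\<^sub>R \<Phi> t)"
    and "(\<Sum>t\<in>T. measure x {t}) \<le> 1"
proof -
  have sx: "sets x = sets borel" and supp: "msupp x \<subseteq> T" and tv: "tv_norm I x \<le> 1"
    using x by (auto simp: primal_feasible_def Bplus_def)
  have meas [measurable]: "(\<lambda>t. indicator I t *\<^sub>R \<Phi> t) \<in> borel_measurable x"
    using set_borel_measurable_continuous_on[OF I] sx by (simp cong: measurable_cong_sets)
  have "I \<in> sets x" "T \<in> sets x"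
    using I(1) T(1) sx by (auto simp: finite_imp_closed)
  have "emeasure x I \<le> 1"
    using tv \<open>I \<in> sets x\<close> by (simp add: tv_norm_def)
  then have eT: "emeasure x T \<le> 1"
    using emeasure_mono[OF T(2) \<open>I \<in> sets x\<close>] by (rule order_trans[rotated])
  have fin: "emeasure x {t} < \<infinity>" if "t \<in> T" for t
    using emeasure_mono[of "{t}" T x] that \<open>T \<in> sets x\<close> eT
    by (auto intro: le_less_trans[of _ 1] order_trans)
  have sing: "{t} \<in> sets x" for t
    using sx by simp
  have T_eq: "T = (\<Union>t\<in>T. {t})" by auto
  have "measure x T = (\<Sum>t\<in>T. measure x {t})"
    by (subst T_eq, rule measure_finite_Union)
       (use T(1) sing fin in \<open>auto simp: disjoint_family_on_def less_top[symmetric]\<close>)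
  moreover have "measure x T \<le> 1"
    using eT by (simp add: measure_def enn2real_leI)
  ultimately show "(\<Sum>t\<in>T. measure x {t}) \<le> 1" by simp
  have "AE t in x. t \<notin> - msupp x"
    by (rule AE_not_in[OF compl_msupp_null[OF sx]])
  then have ae: "AE t in x. indicator I t *\<^sub>R \<Phi> t = (\<Sum>s\<in>T. indicator {s} t *\<^sub>R \<Phi> s)"
  proof eventually_elim
    case (elim t)
    then have "t \<in> T" "t \<in> I" using supp T(2) by auto
    have "(\<Sum>s\<in>T. indicator {s} t *\<^sub>R \<Phi> s) = (\<Sum>s\<in>T. if s = t then \<Phi> s else 0)"
      by (intro sum.cong) auto
    with T(1) \<open>t \<in> T\<close> \<open>t \<in> I\<close> show ?case by simp
  qed
  have int: "integrable x (\<lambda>t. indicator {s} t *\<^sub>R \<Phi> s)" if "s \<in> T" for s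
    using fin[OF that] sing[of s] by (intro integrable_scaleR_left) auto
  have "(LINT t:I|x. \<Phi> t) = integral\<^sup>L x (\<lambda>t. \<Sum>s\<in>T. indicator {s} t *\<^sub>R \<Phi> s)"
    unfolding set_lebesgue_integral_def
    by (intro integral_cong_AE ae meas)
       (use int in \<open>auto intro!: borel_measurable_sum borel_measurable_integrable\<close>)
  also have "\<dots> = (\<Sum>s\<in>T. integral\<^sup>L x (\<lambda>t. indicator {s} t *\<^sub>R \<Phi> s))"
    by (intro Bochner_Integration.integral_sum int)
  also have "\<dots> = (\<Sum>s\<in>T. measure x {s} *\<^sub>R \<Phi> s)"
    using fin sing sets.sets_into_space[OF sing]
    by (intro sum.cong) (auto simp: Int_absorb1)
  finally show "(LINT t:I|x. \<Phi> t) = (\<Sum>t\<in>T. measure x {t} *\<^sub>R \<Phi> t)" .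
qed

text \<open>For finite \<open>T\<close> this is the convex hull of \<open>0\<close> and \<open>\<Phi> ` T\<close>.
  Weights indexed by \<open>T\<close>, rather than by the values of \<open>\<Phi>\<close>, match the masses of a measure on \<open>T\<close>
  even if \<open>\<Phi>\<close> is not injective.\<close>

definition subconvex_combinations :: "'a set \<Rightarrow> ('a \<Rightarrow> 'b::real_vector) \<Rightarrow> 'b set" where
  "subconvex_combinations T \<Phi> = {\<Sum>t\<in>T. w t *\<^sub>R \<Phi> t | w. (\<forall>t\<in>T. 0 \<le> w t) \<and> sum w T \<le> 1}"

text \<open>This reduces the program over measures to a finite-dimensional one: every feasible measure
  acts through its point masses, and every admissible choice of weights comes from an atomic
  measure.\<close>

lemma residual_image_primal_feasible:
  fixes \<Phi> :: "'a::euclidean_space \<Rightarrow> complex ^ 'm"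
  assumes T: "finite T" "T \<subseteq> I" and I: "closed I" "continuous_on I \<Phi>"
  shows "residual I \<Phi> y ` primal_feasible I T = (\<lambda>u. u - y) ` subconvex_combinations T \<Phi>"
proof (intro equalityI subsetI)
  fix z assume "z \<in> residual I \<Phi> y ` primal_feasible I T"
  then obtain x where "x \<in> primal_feasible I T" "z = residual I \<Phi> y x" by blast
  with feasible_integral_eq_sum[OF T I this(1)]
  show "z \<in> (\<lambda>u. u - y) ` subconvex_combinations T \<Phi>"
    unfolding residual_def subconvex_combinations_def by (auto intro!: exI[of _ "\<lambda>t. measure x {t}"])
next
  fix z assume "z \<in> (\<lambda>u. u - y) ` subconvex_combinations T \<Phi>"
  then obtain w where w: "\<And>t. t \<in> T \<Longrightarrow> 0 \<le> w t" "sum w T \<le> 1"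
    and z: "z = (\<Sum>t\<in>T. w t *\<^sub>R \<Phi> t) - y"
    unfolding subconvex_combinations_def by blast
  have "z = residual I \<Phi> y (atomic_measure T w)"
    unfolding residual_def z by (simp add: integral_atomic_measure[OF T I w(1)])
  then show "z \<in> residual I \<Phi> y ` primal_feasible I T"
    using atomic_measure_feasible[OF T I(1) w] by blast
qed

lemma zero_in_subconvex_combinations: "0 \<in> subconvex_combinations T \<Phi>"
  unfolding subconvex_combinations_def by (auto intro!: exI[of _ "\<lambda>_. 0"])

lemma point_in_subconvex_combinations:
  assumes "finite T" "t \<in> T"
  shows "\<Phi> t \<in> subconvex_combinations T \<Phi>"
  unfolding subconvex_combinations_def using assms
  by (auto intro!: exI[of _ "\<lambda>s. if s = t then 1 else 0"]
      simp: if_distrib[of "\<lambda>c. c *\<^sub>R _"] cong: if_cong)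

lemma convex_subconvex_combinations: "convex (subconvex_combinations T \<Phi>)"
proof (rule convexI)
  fix u v and a b :: real
  assume u: "u \<in> subconvex_combinations T \<Phi>" and v: "v \<in> subconvex_combinations T \<Phi>"
    and ab: "0 \<le> a" "0 \<le> b" "a + b = 1"
  obtain p where p: "\<forall>t\<in>T. 0 \<le> p t" "sum p T \<le> 1" "u = (\<Sum>t\<in>T. p t *\<^sub>R \<Phi> t)"
    using u unfolding subconvex_combinations_def by blast
  obtain q where q: "\<forall>t\<in>T. 0 \<le> q t" "sum q T \<le> 1" "v = (\<Sum>t\<in>T. q t *\<^sub>R \<Phi> t)"
    using v unfolding subconvex_combinations_def by blast
  have "(\<Sum>t\<in>T. a * p t + b * q t) = a * sum p T + b * sum q T"
    by (simp add: sum.distrib sum_distrib_left)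
  also have "\<dots> \<le> a * 1 + b * 1"
    using ab p(2) q(2) by (intro add_mono mult_left_mono) auto
  finally have "(\<Sum>t\<in>T. a * p t + b * q t) \<le> 1" using ab by simp
  moreover have "a *\<^sub>R u + b *\<^sub>R v = (\<Sum>t\<in>T. (a * p t + b * q t) *\<^sub>R \<Phi> t)"
    unfolding p(3) q(3) by (simp add: scaleR_sum_right scaleR_add_left sum.distrib)
  ultimately show "a *\<^sub>R u + b *\<^sub>R v \<in> subconvex_combinations T \<Phi>"
    unfolding subconvex_combinations_def using ab p(1) q(1)
    by (auto intro!: exI[of _ "\<lambda>t. a * p t + b * q t"])
qed

text \<open>The constraint \<open>\<alpha> \<ge> 0\<close> accounts for the total weight being possibly below \<open>1\<close>.\<close>

lemma inner_subconvex_combinations_le: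
  fixes \<Phi> :: "'a \<Rightarrow> complex ^ 'm"
  assumes "(lam, \<alpha>) \<in> dual_feasible \<Phi> T" "u \<in> subconvex_combinations T \<Phi>"
  shows "lam \<bullet> u \<le> \<alpha>"
proof -
  have lam: "\<And>t. t \<in> T \<Longrightarrow> lam \<bullet> \<Phi> t \<le> \<alpha>" and "0 \<le> \<alpha>"
    using assms(1) by (auto simp: dual_feasible_def Re_cinner)
  obtain w where w: "\<forall>t\<in>T. 0 \<le> w t" "sum w T \<le> 1" "u = (\<Sum>t\<in>T. w t *\<^sub>R \<Phi> t)"
    using assms(2) unfolding subconvex_combinations_def by blast
  have "lam \<bullet> u = (\<Sum>t\<in>T. w t * (lam \<bullet> \<Phi> t))"
    unfolding w(3) by (simp add: inner_sum_right)
  also have "\<dots> \<le> (\<Sum>t\<in>T. w t * \<alpha>)"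
    using w(1) lam by (intro sum_mono mult_left_mono) auto
  also have "\<dots> = sum w T * \<alpha>"
    by (simp add: sum_distrib_right)
  also have "\<dots> \<le> \<alpha>"
    using w(2) \<open>0 \<le> \<alpha>\<close> mult_right_mono[of "sum w T" 1 \<alpha>] by simp
  finally show ?thesis .
qed

section \<open>First-order conditions\<close>

text \<open>Both results below compare first-order with second-order terms along a segment: after
  division by \<open>e\<close> the quadratic term vanishes as \<open>e\<close> tends to \<open>0\<close>.\<close>

lemma nonneg_if_linear_dominates_quadratic:
  fixes a b :: real
  assumes "\<And>e. 0 < e \<Longrightarrow> e \<le> 1 \<Longrightarrow> 0 \<le> e * a + e\<^sup>2 * b"
  shows "0 \<le> a"
proof (rule tendsto_lowerbound)
  show "((\<lambda>e. a + e * b) \<longlongrightarrow> a) (at_right 0)"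
    by (auto intro!: tendsto_eq_intros)
  show "\<forall>\<^sub>F e in at_right 0. 0 \<le> a + e * b"
  proof (rule eventually_at_rightI[of 0 1])
    fix e :: real assume "e \<in> {0<..<1}"
    with assms[of e] have "0 \<le> e * (a + e * b)" "0 < e"
      by (auto simp: power2_eq_square algebra_simps)
    then show "0 \<le> a + e * b" by (simp add: zero_le_mult_iff)
  qed simp
qed simp

text \<open>The segment from the minimizer to \<open>z\<close> stays in the convex set, and along it the upper bound
  lets \<open>L\<close> grow by at most a linear term plus a quadratic one. A negative linear term would
  lead below the minimum.\<close>

lemma variational_inequality:
  fixes g :: "'b::real_inner"
  assumes upper: "\<And>z. L z - L z0 - (z - z0) \<bullet> g \<le> c * (norm (z - z0))\<^sup>2"
    and S: "convex S" "z0 \<in> S" and min: "\<And>z. z \<in> S \<Longrightarrow> L z0 \<le> L z"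
    and z: "z \<in> S"
  shows "0 \<le> (z - z0) \<bullet> g"
proof (rule nonneg_if_linear_dominates_quadratic[where b = "c * (norm (z - z0))\<^sup>2"])
  fix e :: real assume e: "0 < e" "e \<le> 1"
  let ?p = "z0 + e *\<^sub>R (z - z0)"
  have "?p = (1 - e) *\<^sub>R z0 + e *\<^sub>R z" by (simp add: algebra_simps)
  then have "?p \<in> S"
    using S z e by (auto intro: convexD)
  from min[OF this] upper[of ?p]
  show "0 \<le> e * ((z - z0) \<bullet> g) + e\<^sup>2 * (c * (norm (z - z0))\<^sup>2)"
    by (simp add: power_mult_distrib mult.left_commute)
qed

text \<open>A subgradient \<open>h\<close> bounds \<open>L\<close> from below by the slope \<open>h\<close>, while the assumption bounds it from
  above by the slope \<open>g\<close> up to a quadratic term. In the direction \<open>h - g\<close> the two bounds are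
  incompatible unless \<open>h = g\<close>.\<close>

lemma subgradient_unique:
  fixes g :: "'b::real_inner"
  assumes upper: "\<And>z. L z - L z0 - (z - z0) \<bullet> g \<le> c * (norm (z - z0))\<^sup>2"
    and sub: "\<And>z. h \<bullet> z - L z \<le> h \<bullet> z0 - L z0"
  shows "h = g"
proof -
  define d where "d = h - g"
  then have h: "h = g + d" by simp
  have "0 \<le> - (d \<bullet> d)"
  proof (rule nonneg_if_linear_dominates_quadratic[where b = "c * (norm d)\<^sup>2"])
    fix e :: real assume "0 < e" "e \<le> 1"
    from upper[of "z0 + e *\<^sub>R d"] sub[of "z0 + e *\<^sub>R d"]
    show "0 \<le> e * - (d \<bullet> d) + e\<^sup>2 * (c * (norm d)\<^sup>2)"
      by (simp add: h power_mult_distrib inner_simps inner_commute algebra_simps)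
  qed
  then have "d \<bullet> d = 0"
    using inner_ge_zero[of d] by linarith
  then show ?thesis by (simp add: h)
qed

section \<open>Duality between the subproblems\<close>

lemma fenchel_young: "ereal (lam \<bullet> z - L z) \<le> fenchel_conj L lam"
  unfolding fenchel_conj_def Re_cinner by (rule SUP_upper) simp

text \<open>The affine minorant of slope \<open>g\<close> touching \<open>L\<close> at \<open>z0\<close> makes \<open>z0\<close> a maximizer in the supremum
  that defines the conjugate.\<close>

lemma fenchel_conj_at_subgradient:
  assumes "\<And>z. L z0 + (z - z0) \<bullet> g \<le> L z"
  shows "fenchel_conj L g = ereal (g \<bullet> z0 - L z0)"
proof (rule antisym)
  show "fenchel_conj L g \<le> ereal (g \<bullet> z0 - L z0)"
    unfolding fenchel_conj_def Re_cinner
    using assms by (intro SUP_least) (simp add: inner_simps inner_commute algebra_simps)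
qed (rule fenchel_young)

text \<open>Fenchel-Young at the point \<open>u - y\<close> bounds the dual objective by
  \<open>lam \<bullet> u - \<alpha> + L (u - y)\<close>, and \<open>lam \<bullet> u \<le> \<alpha>\<close> by dual feasibility.\<close>

lemma weak_duality:
  assumes "(lam, \<alpha>) \<in> dual_feasible \<Phi> T" "u \<in> subconvex_combinations T \<Phi>"
  shows "dual_objective L y (lam, \<alpha>) \<le> ereal (L (u - y))"
  using inner_subconvex_combinations_le[OF assms] fenchel_young[of "- lam" "u - y" L]
  by (cases "fenchel_conj L (- lam)")
     (auto simp: dual_objective_def Re_cinner inner_simps)

text \<open>The number \<open>- (g \<bullet> u)\<close> is the maximum of \<open>- g\<close> over the hull, by the variational inequality at
  \<open>u\<close>. Evaluated at \<open>0\<close> and at the points \<open>\<Phi> t\<close>, that inequality gives exactly the dual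
  constraints.\<close>

lemma strong_duality:
  fixes L :: "complex ^ 'm \<Rightarrow> real"
  assumes T: "finite T"
    and lower: "\<And>z. L (u - y) + (z - (u - y)) \<bullet> g \<le> L z"
    and upper: "\<And>z. L z - L (u - y) - (z - (u - y)) \<bullet> g \<le> c * (norm (z - (u - y)))\<^sup>2"
    and u: "u \<in> subconvex_combinations T \<Phi>"
    and min: "\<And>v. v \<in> subconvex_combinations T \<Phi> \<Longrightarrow> L (u - y) \<le> L (v - y)"
  shows "(- g, - (g \<bullet> u)) \<in> dual_feasible \<Phi> T"
    and "dual_objective L y (- g, - (g \<bullet> u)) = ereal (L (u - y))"
proof -
  have var: "0 \<le> (v - u) \<bullet> g" if "v \<in> subconvex_combinations T \<Phi>" for v
    using variational_inequality[OF upper, of "(\<lambda>v. v - y) ` subconvex_combinations T \<Phi>" "v - y"]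
      convex_translation_subtract[OF convex_subconvex_combinations[of T \<Phi>], of y] u min that
    by auto
  show "(- g, - (g \<bullet> u)) \<in> dual_feasible \<Phi> T"
    using var[OF zero_in_subconvex_combinations] var[OF point_in_subconvex_combinations[OF T]]
    by (auto simp: dual_feasible_def Re_cinner inner_simps inner_commute)
  show "dual_objective L y (- g, - (g \<bullet> u)) = ereal (L (u - y))"
    by (simp add: dual_objective_def Re_cinner fenchel_conj_at_subgradient[OF lower] inner_simps)
qed

text \<open>A dual value as large as \<open>L (u - y)\<close> forces equality in Fenchel-Young for \<open>- lam\<close> at \<open>u - y\<close>,
  which says that \<open>- lam\<close> is a subgradient of \<open>L\<close> there.\<close>

lemma dual_optimal_multiplier:
  fixes L :: "complex ^ 'm \<Rightarrow> real"
  assumes upper: "\<And>z. L z - L (u - y) - (z - (u - y)) \<bullet> g \<le> c * (norm (z - (u - y)))\<^sup>2"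
    and u: "u \<in> subconvex_combinations T \<Phi>"
    and lam: "(lam, \<alpha>) \<in> dual_feasible \<Phi> T"
    and opt: "ereal (L (u - y)) \<le> dual_objective L y (lam, \<alpha>)"
  shows "lam = - g"
proof -
  have "fenchel_conj L (- lam) \<le> ereal ((- lam) \<bullet> (u - y) - L (u - y))"
    using opt inner_subconvex_combinations_le[OF lam u]
    by (cases "fenchel_conj L (- lam)") (auto simp: dual_objective_def Re_cinner inner_simps)
  then have "ereal ((- lam) \<bullet> z - L z) \<le> ereal ((- lam) \<bullet> (u - y) - L (u - y))" for z
    using fenchel_young order_trans by blast
  then have "- lam = g"
    by (intro subgradient_unique[OF upper]) auto
  then show ?thesis by auto
qed

text \<open>The bounds on \<open>L\<close> are convexity and a quadratic upper bound with constant \<open>c\<close>. The minimizer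
  \<open>x\<close> is a hypothesis because each CGM iteration supplies one.\<close>

lemma primal_dual_subproblems:
  fixes L :: "complex ^ 'm \<Rightarrow> real"
  assumes T: "finite T" "T \<subseteq> I" and I: "closed I" "continuous_on I \<Phi>"
    and lower: "\<And>z z'. L z' + (z - z') \<bullet> grad L z' \<le> L z"
    and upper: "\<And>z z'. L z - L z' - (z - z') \<bullet> grad L z' \<le> c * (norm (z - z'))\<^sup>2"
    and x: "is_arg_min (\<lambda>x. L (residual I \<Phi> y x)) (\<lambda>x. x \<in> primal_feasible I T) x"
  shows "(INF x\<in>primal_feasible I T. ereal (L (residual I \<Phi> y x)))
       = (SUP p\<in>dual_feasible \<Phi> T. dual_objective L y p)"
    and "is_arg_max (dual_objective L y) (\<lambda>p. p \<in> dual_feasible \<Phi> T) (lam, \<alpha>)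
       \<Longrightarrow> lam = - grad L (residual I \<Phi> y x)"
proof -
  let ?K = "subconvex_combinations T \<Phi>"
  define u where "u = residual I \<Phi> y x + y"
  define g where "g = grad L (u - y)"
  note image = residual_image_primal_feasible[OF T I, of y]
  have xu: "residual I \<Phi> y x = u - y" by (simp add: u_def)
  have xf: "x \<in> primal_feasible I T"
    and xmin: "\<And>x'. x' \<in> primal_feasible I T \<Longrightarrow> L (u - y) \<le> L (residual I \<Phi> y x')"
    using x by (auto simp: is_arg_min_def xu not_less)
  have u: "u \<in> ?K"
    using xf image xu by (metis (no_types, lifting) diff_add_cancel imageE imageI)
  have min: "L (u - y) \<le> L (v - y)" if "v \<in> ?K" for v
  proof -
    have "v - y \<in> residual I \<Phi> y ` primal_feasible I T" using that image by simp
    then show ?thesis using xmin by auto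
  qed
  note strong = strong_duality[OF T(1) lower upper u min, folded g_def]
  have "(INF x\<in>primal_feasible I T. ereal (L (residual I \<Phi> y x))) = ereal (L (u - y))"
    using xf xmin xu by (intro antisym INF_greatest INF_lower2[of x]) auto
  moreover have "(SUP p\<in>dual_feasible \<Phi> T. dual_objective L y p) = ereal (L (u - y))"
  proof (rule antisym)
    show "(SUP p\<in>dual_feasible \<Phi> T. dual_objective L y p) \<le> ereal (L (u - y))"
    proof (rule SUP_least)
      fix p assume "p \<in> dual_feasible \<Phi> T"
      then show "dual_objective L y p \<le> ereal (L (u - y))"
        using weak_duality[OF _ u, of "fst p" "snd p"] by simp
    qed
    show "ereal (L (u - y)) \<le> (SUP p\<in>dual_feasible \<Phi> T. dual_objective L y p)"
      using strong by (intro SUP_upper2[of "(- g, - (g \<bullet> u))"]) auto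
  qed
  ultimately show "(INF x\<in>primal_feasible I T. ereal (L (residual I \<Phi> y x)))
      = (SUP p\<in>dual_feasible \<Phi> T. dual_objective L y p)" by simp
  show "lam = - grad L (residual I \<Phi> y x)"
    if "is_arg_max (dual_objective L y) (\<lambda>p. p \<in> dual_feasible \<Phi> T) (lam, \<alpha>)"
  proof -
    have "(lam, \<alpha>) \<in> dual_feasible \<Phi> T"
      and "dual_objective L y (- g, - (g \<bullet> u)) \<le> dual_objective L y (lam, \<alpha>)"
      using that strong(1) by (auto simp: is_arg_max_def not_less)
    then have "(lam, \<alpha>) \<in> dual_feasible \<Phi> T" "ereal (L (u - y)) \<le> dual_objective L y (lam, \<alpha>)"
      using strong(2) by simp_all
    then show ?thesis
      unfolding xu by (rule dual_optimal_multiplier[OF upper u])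
  qed
qed

section \<open>The two runs in lockstep\<close>

lemma candidates_coincide:
  "em_candidates I \<Phi> (- grad L (residual I \<Phi> y x)) = cgm_candidates I \<Phi> L y x"
  unfolding em_candidates_def cgm_candidates_def is_arg_max_def is_arg_min_def Re_cinner
  by (simp add: inner_commute)

text \<open>On the empty support every feasible measure has residual \<open>- y\<close>, so the starting point of CGM is
  optimal for the program of iteration \<open>0\<close>. This lets the induction treat \<open>l = 0\<close> like the
  other iterations.\<close>

lemma cgm_initial_arg_min:
  fixes \<Phi> :: "'a::euclidean_space \<Rightarrow> complex ^ 'm"
    and L :: "complex ^ 'm \<Rightarrow> real"
  assumes I: "closed I" "continuous_on I \<Phi>"
  shows "is_arg_min (\<lambda>x. L (residual I \<Phi> y x)) (\<lambda>x. x \<in> primal_feasible I {}) (null_measure borel)"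
proof -
  have "msupp (null_measure borel :: 'a measure) = {}"
    using open_null_disjoint_msupp[of UNIV "null_measure borel :: 'a measure"] by simp
  moreover have "tv_norm I (null_measure borel) \<le> 1"
    using I(1) by (simp add: tv_norm_def)
  ultimately have "null_measure borel \<in> primal_feasible I {}"
    by (simp add: primal_feasible_def Bplus_def)
  moreover have "residual I \<Phi> y x = - y" if "x \<in> primal_feasible I {}" for x
    using feasible_integral_eq_sum(1)[OF _ _ I that] by (simp add: residual_def)
  ultimately show ?thesis
    by (simp add: is_arg_min_def)
qed

lemma cgm_run_invariant:
  fixes \<Phi> :: "'a::euclidean_space \<Rightarrow> complex ^ 'm"
  assumes run: "cgm_run I \<Phi> L y \<eta> N T x t" and I: "closed I" "continuous_on I \<Phi>"
    and "l \<le> N"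
  shows "finite (T l) \<and> T l \<subseteq> I \<and>
    is_arg_min (\<lambda>x. L (residual I \<Phi> y x)) (\<lambda>x. x \<in> primal_feasible I (T l)) (x l)"
  using \<open>l \<le> N\<close>
proof (induction l)
  case 0
  then show ?case
    using run cgm_initial_arg_min[OF I] by (simp add: cgm_run_def)
next
  case (Suc l)
  then have "Suc l \<in> {1..N}" by simp
  with run have "t (Suc l) \<in> cgm_candidates I \<Phi> L y (x l)" "T (Suc l) = T l \<union> {t (Suc l)}"
    "is_arg_min (\<lambda>x. L (residual I \<Phi> y x)) (\<lambda>x. x \<in> primal_feasible I (T (Suc l))) (x (Suc l))"
    unfolding cgm_run_def by (metis diff_Suc_1)+
  with Suc show ?case
    by (auto simp: cgm_candidates_def is_arg_min_def)
qed

theorem proposition2: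
  fixes I :: "'a::euclidean_space set"
    and \<Phi> :: "'a \<Rightarrow> complex ^ 'm"
    and y :: "complex ^ 'm"
    and L :: "complex ^ 'm \<Rightarrow> real"
    and \<gamma> \<eta>\<^sub>C \<eta>\<^sub>E :: real
    and N\<^sub>C N\<^sub>E :: nat
    and rule :: "'a set \<Rightarrow> 'a"
  assumes "compact I"
    and "continuous_on I \<Phi>"
    and "\<And>z. L differentiable (at z)"
    and "\<gamma> \<ge> 1"
    and "\<And>x x'. (norm (x - x'))\<^sup>2 / (2 * \<gamma>) \<le> L x - L x' - Re (cinner (x - x') (grad L x'))"
    and "\<And>x x'. L x - L x' - Re (cinner (x - x') (grad L x')) \<le> \<gamma> / 2 * (norm (x - x'))\<^sup>2"
    and "\<eta>\<^sub>C \<ge> 0" and "\<eta>\<^sub>E \<ge> 0"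
    and "cgm_run I \<Phi> L y \<eta>\<^sub>C N\<^sub>C T\<^sub>C x t\<^sub>C"
    and "em_run I \<Phi> L y \<eta>\<^sub>E N\<^sub>E T\<^sub>E lam \<alpha> t\<^sub>E"
    and "\<And>l. l \<in> {1..N\<^sub>C} \<Longrightarrow> t\<^sub>C l = rule (cgm_candidates I \<Phi> L y (x (l - 1)))"
    and "\<And>l. l \<in> {1..N\<^sub>E} \<Longrightarrow> t\<^sub>E l = rule (em_candidates I \<Phi> (lam l))"
  shows "\<forall>l \<le> min N\<^sub>C N\<^sub>E. T\<^sub>C l = T\<^sub>E l \<and>
           cgm_value I \<Phi> L y T\<^sub>C l = em_value \<Phi> L y T\<^sub>E (l + 1)"
proof -
  have I: "closed I" "continuous_on I \<Phi>"
    using assms(1,2) by (auto simp: compact_imp_closed)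
  have lower: "L z' + (z - z') \<bullet> grad L z' \<le> L z" for z z'
  proof -
    have "0 \<le> (norm (z - z'))\<^sup>2 / (2 * \<gamma>)" using assms(4) by simp
    with assms(5)[of z z'] show ?thesis by (simp add: Re_cinner)
  qed
  have upper: "L z - L z' - (z - z') \<bullet> grad L z' \<le> \<gamma> / 2 * (norm (z - z'))\<^sup>2" for z z'
    using assms(6)[of z z'] by (simp add: Re_cinner)
  note inv = cgm_run_invariant[OF assms(9) I]
  have T_eq: "T\<^sub>C l = T\<^sub>E l" if "l \<le> min N\<^sub>C N\<^sub>E" for l
    using that
  proof (induction l)
    case 0
    then show ?case using assms(9,10) by (simp add: cgm_run_def em_run_def)
  next
    case (Suc l)
    then have IH: "T\<^sub>C l = T\<^sub>E l" and l: "l \<le> N\<^sub>C" "Suc l \<in> {1..N\<^sub>C}" "Suc l \<in> {1..N\<^sub>E}" by auto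
    have C: "T\<^sub>C (Suc l) = T\<^sub>C l \<union> {t\<^sub>C (Suc l)}"
      using assms(9) l(2) unfolding cgm_run_def by (metis diff_Suc_1)
    have E: "T\<^sub>E (Suc l) = T\<^sub>E l \<union> {t\<^sub>E (Suc l)}"
      and "is_arg_max (dual_objective L y) (\<lambda>p. p \<in> dual_feasible \<Phi> (T\<^sub>E l))
             (lam (Suc l), \<alpha> (Suc l))"
      using assms(10) l(3) unfolding em_run_def by (metis diff_Suc_1)+
    then have "lam (Suc l) = - grad L (residual I \<Phi> y (x l))"
      using primal_dual_subproblems(2)[OF _ _ I lower upper, of "T\<^sub>C l"] inv[OF l(1)] IH by metis
    then have "em_candidates I \<Phi> (lam (Suc l)) = cgm_candidates I \<Phi> L y (x l)"
      by (simp only: candidates_coincide)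
    then have "t\<^sub>C (Suc l) = t\<^sub>E (Suc l)"
      using assms(11)[OF l(2)] assms(12)[OF l(3)] by simp
    with C E IH show ?case by simp
  qed
  have "cgm_value I \<Phi> L y T\<^sub>C l = em_value \<Phi> L y T\<^sub>E (l + 1)" if "l \<le> min N\<^sub>C N\<^sub>E" for l
  proof -
    from that have "l \<le> N\<^sub>C" by simp
    note inv_l = inv[OF this]
    show ?thesis
      unfolding cgm_value_def em_value_def
      using primal_dual_subproblems(1)[OF _ _ I lower upper, of "T\<^sub>C l" y "x l"] inv_l T_eq[OF that]
      by simp
  qed
  with T_eq show ?thesis by blast
qed

end
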